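(* Up to combinatorial equivalence, the set of Forman--Ricci-positive simplicial $5$-dimensional polytopes is finite.
   Context: Polytopes are convex polytopes, considered up to combinatorial equivalence. A $d$-polytope is simplicial if all of its proper faces are simplices. For an edge $e$ of a polytope $P$, let $\mathcal{F}\uparrow(e)$ be the set of $2$-faces of $P$ containing $e$. Two distinct edges $e,e'$ are parallel neighbors if either (i) they share a vertex but are not contained in a common $2$-face, or (ii) they are vertex-disjoint but are contained in a common $2$-face. Let $\mathcal{E}(e)$ be the set of parallel neighbors of $e$. The Forman--Ricci curvature of $e$ is $\mathcal{F}(e)=|\mathcal{F}\uparrow(e)|+2-|\mathcal{E}(e)|$. A polytope is Forman--Ricci-positive if $\mathcal{F}(e)>0$ for every edge $e$. *)

theory Defs
  imports "HOL-Analysis.Analysis"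
begin

text \<open>
  Faces are those of \<^const>\<open>face_of\<close>, hence include the empty face and the polytope itself.
  A combinatorial equivalence is an isomorphism of face lattices ordered by inclusion.
\<close>

definition comb_equiv :: "'a::euclidean_space set \<Rightarrow> 'b::euclidean_space set \<Rightarrow> bool" where
  "comb_equiv P Q \<longleftrightarrow>
     (\<exists>\<phi>. bij_betw \<phi> {F. F face_of P} {G. G face_of Q} \<and>
          (\<forall>F F'. F face_of P \<longrightarrow> F' face_of P \<longrightarrow> (F \<subseteq> F' \<longleftrightarrow> \<phi> F \<subseteq> \<phi> F')))"

definition comb_equiv_rel :: "('a::euclidean_space set \<times> 'a set) set" where
  "comb_equiv_rel = {(P, Q). polytope P \<and> polytope Q \<and> comb_equiv P Q}"

definition d_polytope :: "nat \<Rightarrow> 'a::euclidean_space set \<Rightarrow> bool" where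
  "d_polytope d P \<longleftrightarrow> polytope P \<and> aff_dim P = int d"

definition simplicial_polytope :: "'a::euclidean_space set \<Rightarrow> bool" where
  "simplicial_polytope P \<longleftrightarrow>
     polytope P \<and> (\<forall>F. F face_of P \<and> F \<noteq> P \<longrightarrow> (\<exists>n. n simplex F))"

definition two_face_of :: "'a::euclidean_space set \<Rightarrow> 'a set \<Rightarrow> bool" where
  "two_face_of F P \<longleftrightarrow> F face_of P \<and> aff_dim F = 2"

definition two_faces_above :: "'a::euclidean_space set \<Rightarrow> 'a set \<Rightarrow> 'a set set" where
  "two_faces_above P e = {F. two_face_of F P \<and> e \<subseteq> F}"

definition share_vertex :: "'a::euclidean_space set \<Rightarrow> 'a set \<Rightarrow> 'a set \<Rightarrow> bool" where
  "share_vertex P e e' \<longleftrightarrow> (\<exists>v. v extreme_point_of P \<and> v \<in> e \<and> v \<in> e')"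

definition in_common_two_face :: "'a::euclidean_space set \<Rightarrow> 'a set \<Rightarrow> 'a set \<Rightarrow> bool" where
  "in_common_two_face P e e' \<longleftrightarrow> (\<exists>F. two_face_of F P \<and> e \<subseteq> F \<and> e' \<subseteq> F)"

definition parallel_neighbors :: "'a::euclidean_space set \<Rightarrow> 'a set \<Rightarrow> 'a set set" where
  "parallel_neighbors P e =
     {e'. e' edge_of P \<and> e' \<noteq> e \<and>
          (share_vertex P e e' \<and> \<not> in_common_two_face P e e' \<or>
           \<not> share_vertex P e e' \<and> in_common_two_face P e e')}"

definition forman_ricci :: "'a::euclidean_space set \<Rightarrow> 'a set \<Rightarrow> int" where
  "forman_ricci P e =
     int (card (two_faces_above P e)) + 2 - int (card (parallel_neighbors P e))"

definition forman_ricci_positive :: "'a::euclidean_space set \<Rightarrow> bool" where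
  "forman_ricci_positive P \<longleftrightarrow> polytope P \<and> (\<forall>e. e edge_of P \<longrightarrow> forman_ricci P e > 0)"

lemma comb_equiv_refl: "comb_equiv P P"
  unfolding comb_equiv_def by (intro exI[of _ id]) auto

lemma comb_equiv_sym:
  assumes "comb_equiv P Q"
  shows "comb_equiv Q P"
proof -
  obtain f where bij: "bij_betw f {F. F face_of P} {G. G face_of Q}"
    and f: "\<And>F F'. F face_of P \<Longrightarrow> F' face_of P \<Longrightarrow> F \<subseteq> F' \<longleftrightarrow> f F \<subseteq> f F'"
    using assms unfolding comb_equiv_def by blast
  let ?g = "inv_into {F. F face_of P} f"
  have g: "?g G face_of P" "f (?g G) = G" if "G face_of Q" for G
    using bij_betw_apply[OF bij_betw_inv_into[OF bij]] bij_betw_inv_into_right[OF bij] that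
    by auto
  have "G \<subseteq> G' \<longleftrightarrow> ?g G \<subseteq> ?g G'" if "G face_of Q" "G' face_of Q" for G G'
    using f[of "?g G" "?g G'"] g that by simp
  with bij_betw_inv_into[OF bij] show ?thesis
    unfolding comb_equiv_def by blast
qed

lemma comb_equiv_trans:
  assumes "comb_equiv P Q" "comb_equiv Q R"
  shows "comb_equiv P R"
proof -
  obtain f where bf: "bij_betw f {F. F face_of P} {G. G face_of Q}"
    and f: "\<And>F F'. F face_of P \<Longrightarrow> F' face_of P \<Longrightarrow> F \<subseteq> F' \<longleftrightarrow> f F \<subseteq> f F'"
    using assms(1) unfolding comb_equiv_def by blast
  obtain g where bg: "bij_betw g {F. F face_of Q} {G. G face_of R}"
    and g: "\<And>F F'. F face_of Q \<Longrightarrow> F' face_of Q \<Longrightarrow> F \<subseteq> F' \<longleftrightarrow> g F \<subseteq> g F'"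
    using assms(2) unfolding comb_equiv_def by blast
  have fQ: "f F face_of Q" if "F face_of P" for F
    using bij_betw_apply[OF bf] that by auto
  have "F \<subseteq> F' \<longleftrightarrow> (g \<circ> f) F \<subseteq> (g \<circ> f) F'" if "F face_of P" "F' face_of P" for F F'
    using f[OF that] g[OF fQ fQ, OF that] by simp
  with bij_betw_trans[OF bf bg] show ?thesis
    unfolding comb_equiv_def by blast
qed

lemma equiv_comb_equiv_rel: "equiv {P. polytope P} comb_equiv_rel"
proof (rule equivI)
  show "comb_equiv_rel \<subseteq> {P. polytope P} \<times> {P. polytope P}"
    by (auto simp: comb_equiv_rel_def)
  show "refl_on {P. polytope P} comb_equiv_rel"
    by (auto simp: refl_on_def comb_equiv_rel_def comb_equiv_refl)
  show "sym comb_equiv_rel"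
    by (auto simp: sym_def comb_equiv_rel_def intro: comb_equiv_sym)
  show "trans comb_equiv_rel"
    by (auto simp: trans_def comb_equiv_rel_def intro: comb_equiv_trans)
qed

end

theory Submission
  imports Defs
begin

text \<open>
  Let \<open>d\<^sub>u\<close> be the degree of a vertex \<open>u\<close> and \<open>t\<^sub>u\<^sub>v\<close> the number of triangles at an edge \<open>uv\<close>. Since all
  2-faces are triangles, positivity of the curvature reads \<open>d\<^sub>u + d\<^sub>v \<le> 3 t\<^sub>u\<^sub>v + 3\<close>.

  Summed along a geodesic, this inequality telescopes, as in Myers' theorem, to a bound on the
  length of a geodesic in terms of the degrees of its endpoints. Since also \<open>d\<^sub>v \<le> 2 d\<^sub>u\<close>
  for adjacent vertices, the vertices of degree at most \<open>K\<close> lie in a ball of bounded radius in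
  which all degrees are bounded, so their number is bounded in terms of \<open>K\<close>.

  Summed over all edges, the inequality gives \<open>\<Sum> d\<^sub>u\<^sup>2 \<le> K \<Sum> d\<^sub>u\<close>, because in dimension 5 the
  number of facets, hence also that of triangles, is at most a constant multiple of the number of
  edges. So the vertices of degree above \<open>K\<close> are outweighed by those of degree at most \<open>K\<close>,
  and the total number of vertices is bounded.
\<close>

section \<open>Graphs with triangles of positive curvature\<close>

text \<open>\<open>R\<close> holds both orientations of each edge, \<open>A u v\<close> the third
  vertices of the triangles at \<open>uv\<close>. Only inclusion of \<open>A u v\<close> in the
  common neighbourhood is assumed: three pairwise adjacent vertices need not span a face.\<close>

locale positively_curved_graph =
  fixes V :: "'v set" and R :: "('v \<times> 'v) set" and A :: "'v \<Rightarrow> 'v \<Rightarrow> 'v set"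
  assumes finite_V: "finite V"
    and R_sub: "R \<subseteq> V \<times> V"
    and sym_R: "sym R"
    and irrefl_R: "(u, u) \<notin> R"
    and A_sub: "(u, v) \<in> R \<Longrightarrow> A u v \<subseteq> R `` {u} \<inter> R `` {v}"
    and curvature: "(u, v) \<in> R \<Longrightarrow>
      card (R `` {u}) + card (R `` {v}) \<le> 3 * card (A u v) + 3"
begin

definition deg :: "'v \<Rightarrow> nat" where
  "deg u = card (R `` {u})"

lemma finite_nbrs: "finite (R `` {u})"
  using finite_V R_sub by (metis Image_subset finite_subset)

lemma finite_A: "(u, v) \<in> R \<Longrightarrow> finite (A u v)"
  using A_sub finite_nbrs by (meson finite_Int finite_subset)

text \<open>The other endpoint is a neighbour but never the third vertex of a triangle at the
  edge.\<close>

lemma card_A_less_deg: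
  assumes "(u, v) \<in> R"
  shows "card (A u v) < deg u" "card (A u v) < deg v"
proof -
  have "v \<in> R `` {u} - A u v" "u \<in> R `` {v} - A u v"
    using assms A_sub[OF assms] irrefl_R sym_R by (auto dest: symD)
  then have "A u v \<subset> R `` {u}" "A u v \<subset> R `` {v}"
    using A_sub[OF assms] by blast+
  then show "card (A u v) < deg u" "card (A u v) < deg v"
    unfolding deg_def by (simp_all add: finite_nbrs psubset_card_mono)
qed

lemma deg_sum_le: "(u, v) \<in> R \<Longrightarrow> deg u + deg v \<le> 3 * card (A u v) + 3"
  using curvature by (simp add: deg_def)

text \<open>At most \<open>deg u - 1\<close> triangles contain \<open>uv\<close>, so the right side
  of the curvature inequality is at most \<open>3 * deg u\<close>.\<close>

lemma deg_adjacent_le: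
  assumes "(u, v) \<in> R"
  shows "deg v \<le> 2 * deg u"
  using deg_sum_le[OF assms] card_A_less_deg(1)[OF assms] by linarith

section \<open>A Myers-type bound on the length of geodesics\<close>

text \<open>Shortness is demanded between any two points of the path, so it applies at once to
  segments of length 2 and 3.\<close>

definition geodesic :: "nat \<Rightarrow> (nat \<Rightarrow> 'v) \<Rightarrow> bool" where
  "geodesic n p \<longleftrightarrow> (\<forall>i<n. (p i, p (Suc i)) \<in> R) \<and>
     (\<forall>i j m. i \<le> j \<longrightarrow> j \<le> n \<longrightarrow> (p i, p j) \<in> R ^^ m \<longrightarrow> j - i \<le> m)"

lemma path_relpow:
  assumes "\<forall>i<n. (p i, p (Suc i)) \<in> R" "i \<le> j" "j \<le> n"
  shows "(p i, p j) \<in> R ^^ (j - i)"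
  unfolding relpow_fun_conv using assms by (intro exI[of _ "\<lambda>k. p (i + k)"]) auto

lemma geodesic_exists:
  assumes "(u, v) \<in> R\<^sup>*"
  obtains n p where "geodesic n p" "p 0 = u" "p n = v"
proof -
  define n where "n = (LEAST n. (u, v) \<in> R ^^ n)"
  have uv: "(u, v) \<in> R ^^ n" and least: "\<And>m. (u, v) \<in> R ^^ m \<Longrightarrow> n \<le> m"
    using assms unfolding n_def rtrancl_power by (auto intro: LeastI_ex Least_le)
  obtain p where p: "p 0 = u" "p n = v" "\<forall>i<n. (p i, p (Suc i)) \<in> R"
    using uv relpow_fun_conv by metis
  have "j - i \<le> m" if "i \<le> j" "j \<le> n" "(p i, p j) \<in> R ^^ m" for i j m
  proof -
    have "(u, p i) \<in> R ^^ i" "(p j, v) \<in> R ^^ (n - j)"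
      using path_relpow[OF p(3), of 0 i] path_relpow[OF p(3), of j n] p that by auto
    then have "(u, v) \<in> R ^^ (i + m + (n - j))"
      using that(3) unfolding relpow_add by blast
    then show ?thesis using least that by fastforce
  qed
  with p that show thesis unfolding geodesic_def by blast
qed

lemma geodesic_adj: "geodesic n p \<Longrightarrow> i < n \<Longrightarrow> (p i, p (Suc i)) \<in> R"
  by (simp add: geodesic_def)

lemma geodesic_short:
  "geodesic n p \<Longrightarrow> i \<le> j \<Longrightarrow> j \<le> n \<Longrightarrow> (p i, p j) \<in> R ^^ m \<Longrightarrow> j - i \<le> m"
  by (simp add: geodesic_def)

lemma geodesic_prefix: "geodesic n p \<Longrightarrow> k \<le> n \<Longrightarrow> geodesic k p"
  unfolding geodesic_def by fastforce

text \<open>Both sets of triangle vertices lie in the neighbourhood of the middle vertex. So do the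
  two outer vertices, which belong to neither set because they are at distance 2.
  Inclusion-exclusion does the rest.\<close>

lemma geodesic_deg_inner:
  assumes "geodesic n p" "Suc i < n"
  shows "card (A (p i) (p (Suc i))) + card (A (p (Suc i)) (p (Suc (Suc i)))) + 2 \<le>
    deg (p (Suc i)) + card (A (p i) (p (Suc i)) \<inter> A (p (Suc i)) (p (Suc (Suc i))))"
proof -
  let ?a = "p i" and ?b = "p (Suc i)" and ?c = "p (Suc (Suc i))"
  have ab: "(?a, ?b) \<in> R" and bc: "(?b, ?c) \<in> R"
    using assms by (auto intro: geodesic_adj)
  have short: "\<And>m. (?a, ?c) \<in> R ^^ m \<Longrightarrow> 2 \<le> m"
    using geodesic_short[OF assms(1), of i "Suc (Suc i)"] assms(2) by simp
  have ac: "(?a, ?c) \<notin> R" "?a \<noteq> ?c"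
    using short[of 1] short[of 0] by auto
  have notin: "?a \<notin> A ?a ?b \<union> A ?b ?c" "?c \<notin> A ?a ?b \<union> A ?b ?c"
    using A_sub[OF ab] A_sub[OF bc] ac irrefl_R sym_R by (auto dest: symD)
  have fin: "finite (A ?a ?b)" "finite (A ?b ?c)"
    using ab bc finite_A by auto
  have "card (A ?a ?b \<union> A ?b ?c \<union> {?a, ?c}) \<le> deg ?b"
    unfolding deg_def using A_sub[OF ab] A_sub[OF bc] ab bc sym_R
    by (intro card_mono finite_nbrs) (auto dest: symD)
  moreover have "card (A ?a ?b \<union> A ?b ?c \<union> {?a, ?c}) = card (A ?a ?b \<union> A ?b ?c) + 2"
    using notin fin ac by (subst card_Un_disjoint) auto
  ultimately show ?thesis
    using card_Un_Int[OF fin] by linarith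
qed

text \<open>A triangle vertex common to the first and third edge would join points at distance 3 in
  two steps. So the two overlaps are disjoint subsets of the middle set.\<close>

lemma geodesic_triangle_overlap:
  assumes "geodesic n p" "Suc (Suc i) < n"
  shows "card (A (p i) (p (Suc i)) \<inter> A (p (Suc i)) (p (Suc (Suc i)))) +
    card (A (p (Suc i)) (p (Suc (Suc i))) \<inter> A (p (Suc (Suc i))) (p (Suc (Suc (Suc i))))) \<le>
    card (A (p (Suc i)) (p (Suc (Suc i))))"
proof -
  let ?a = "p i" and ?b = "p (Suc i)" and ?c = "p (Suc (Suc i))" and ?d = "p (Suc (Suc (Suc i)))"
  have R: "(?a, ?b) \<in> R" "(?b, ?c) \<in> R" "(?c, ?d) \<in> R"
    using assms by (auto intro: geodesic_adj)
  have short: "\<And>m. (?a, ?d) \<in> R ^^ m \<Longrightarrow> 3 \<le> m"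
    using geodesic_short[OF assms(1), of i "Suc (Suc (Suc i))"] assms(2) by simp
  have "A ?a ?b \<inter> A ?c ?d = {}"
  proof (rule ccontr)
    assume "A ?a ?b \<inter> A ?c ?d \<noteq> {}"
    then obtain w where "(?a, w) \<in> R" "(w, ?d) \<in> R"
      using A_sub[OF R(1)] A_sub[OF R(3)] symD[OF sym_R] by blast
    then have "(?a, ?d) \<in> R ^^ 2"
      by (auto simp: numeral_2_eq_2)
    then show False using short by fastforce
  qed
  then have "card (A ?a ?b \<inter> A ?b ?c) + card (A ?b ?c \<inter> A ?c ?d) =
      card (A ?a ?b \<inter> A ?b ?c \<union> A ?b ?c \<inter> A ?c ?d)"
    using finite_A[OF R(2)] by (intro card_Un_disjoint[symmetric]) auto
  also have "\<dots> \<le> card (A ?b ?c)"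
    using finite_A[OF R(2)] by (intro card_mono) auto
  finally show ?thesis .
qed

lemma geodesic_length_le:
  assumes "geodesic (Suc (Suc k)) p"
  shows "deg (p 0) + deg (p (Suc (Suc k))) + k \<le>
    2 + card (A (p 0) (p (Suc 0))) + card (A (p (Suc k)) (p (Suc (Suc k)))) +
    card (A (p 0) (p (Suc 0)) \<inter> A (p (Suc 0)) (p (Suc (Suc 0)))) +
    card (A (p k) (p (Suc k)) \<inter> A (p (Suc k)) (p (Suc (Suc k))))"
  using assms
proof (induction k)
  case 0
  have "deg (p 0) + deg (p (Suc 0)) \<le> 3 * card (A (p 0) (p (Suc 0))) + 3"
    "deg (p (Suc 0)) + deg (p (Suc (Suc 0))) \<le> 3 * card (A (p (Suc 0)) (p (Suc (Suc 0)))) + 3"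
    using 0 by (simp_all add: deg_sum_le geodesic_adj)
  \<comment> \<open>With two edges the two overlap terms coincide; both curvature inequalities and
    twice the one at the middle vertex add up to the claim.\<close>
  with geodesic_deg_inner[OF 0, of 0] show ?case
    by linarith
next
  case (Suc k)
  have "geodesic (Suc (Suc k)) p"
    by (rule geodesic_prefix[OF Suc.prems]) simp
  note IH = Suc.IH[OF this]
  have "deg (p (Suc (Suc k))) + deg (p (Suc (Suc (Suc k)))) \<le>
      3 * card (A (p (Suc (Suc k))) (p (Suc (Suc (Suc k))))) + 3"
    using Suc.prems by (simp add: deg_sum_le geodesic_adj)
  \<comment> \<open>Add the induction hypothesis, the curvature of the new edge, twice the
    inequality at \<open>p (Suc (Suc k))\<close> and the overlap inequality. The surplus
    \<open>2 * 2 - 3 = 1\<close> is the growth of \<open>k\<close>.\<close>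
  with IH geodesic_deg_inner[OF Suc.prems, of "Suc k"]
    geodesic_triangle_overlap[OF Suc.prems, of k] show ?case
    by linarith
qed

text \<open>The terms in the middle of the path telescope away in \<open>geodesic_length_le\<close>, so only data
  at the two endpoints bound the length.\<close>

lemma geodesic_low_degree:
  assumes "geodesic n p" "deg (p 0) \<le> K" "deg (p n) \<le> K"
  shows "n \<le> 2 * K + 2"
proof (cases "n \<ge> 2")
  case True
  define k where "k = n - 2"
  have n: "n = Suc (Suc k)"
    using True by (simp add: k_def)
  have e: "(p 0, p (Suc 0)) \<in> R" "(p (Suc k), p n) \<in> R"
    using geodesic_adj[OF assms(1), of 0] geodesic_adj[OF assms(1), of "Suc k"] n by auto
  have "card (A (p 0) (p (Suc 0)) \<inter> A (p (Suc 0)) (p (Suc (Suc 0)))) \<le> card (A (p 0) (p (Suc 0)))"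
    "card (A (p k) (p (Suc k)) \<inter> A (p (Suc k)) (p n)) \<le> card (A (p (Suc k)) (p n))"
    using e by (simp_all add: card_mono finite_A)
  \<comment> \<open>Overlaps are at most the triangle numbers of the end edges, which are below the
    end degrees, so \<open>k\<close> is at most \<open>deg (p 0) + deg (p n) - 2\<close>.\<close>
  with geodesic_length_le[OF assms(1)[unfolded n]] assms
    card_A_less_deg(1)[OF e(1)] card_A_less_deg(2)[OF e(2)]
  show ?thesis unfolding n by linarith
qed auto

section \<open>Balls and the number of vertices of low degree\<close>

lemma deg_relpow_le:
  assumes "(u, v) \<in> R ^^ m"
  shows "deg v \<le> deg u * 2 ^ m"
  using assms
proof (induction m arbitrary: v)
  case (Suc m)
  then obtain w where "(u, w) \<in> R ^^ m" "(w, v) \<in> R" by auto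
  with Suc.IH[of w] deg_adjacent_le[of w v] show ?case by auto
qed auto

definition nbhd :: "nat \<Rightarrow> 'v \<Rightarrow> 'v set" where
  "nbhd r u = {v. \<exists>m\<le>r. (u, v) \<in> R ^^ m}"

lemma nbhd_Suc_subset: "nbhd (Suc r) u \<subseteq> (\<Union>w\<in>nbhd r u. insert w (R `` {w}))"
proof
  fix v assume "v \<in> nbhd (Suc r) u"
  then obtain m where m: "m \<le> Suc r" "(u, v) \<in> R ^^ m"
    unfolding nbhd_def by blast
  show "v \<in> (\<Union>w\<in>nbhd r u. insert w (R `` {w}))"
  proof (cases "m \<le> r")
    case True
    with m(2) show ?thesis unfolding nbhd_def by blast
  next
    case False
    with m(1) have "m = Suc r" by simp
    with m(2) obtain w where "(u, w) \<in> R ^^ r" "(w, v) \<in> R" by auto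
    then show ?thesis unfolding nbhd_def by blast
  qed
qed

text \<open>Degrees at most double with each step, so enlarging the radius by one multiplies the
  ball by at most the current degree bound plus one; one common factor is used for all
  layers.\<close>

lemma nbhd_bound:
  assumes "deg u \<le> K"
  shows "finite (nbhd r u) \<and> card (nbhd r u) \<le> (K * 2 ^ r + 1) ^ r"
proof (induction r)
  case 0
  have "nbhd 0 u = {u}" by (auto simp: nbhd_def)
  then show ?case by simp
next
  case (Suc r)
  then have IH: "finite (nbhd r u)" "card (nbhd r u) \<le> (K * 2 ^ r + 1) ^ r"
    by blast+
  have step: "card (insert w (R `` {w})) \<le> K * 2 ^ Suc r + 1" if w: "w \<in> nbhd r u" for w
  proof -
    obtain m where m: "m \<le> r" "(u, w) \<in> R ^^ m"
      using w unfolding nbhd_def by blast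
    have "deg w \<le> deg u * 2 ^ m"
      by (rule deg_relpow_le[OF m(2)])
    also have "\<dots> \<le> K * 2 ^ Suc r"
      using m(1) assms by (intro mult_le_mono power_increasing) simp_all
    finally show ?thesis
      using irrefl_R by (simp add: finite_nbrs deg_def)
  qed
  have fin: "finite (\<Union>w\<in>nbhd r u. insert w (R `` {w}))"
    using IH(1) finite_nbrs by simp
  have "card (nbhd (Suc r) u) \<le> card (\<Union>w\<in>nbhd r u. insert w (R `` {w}))"
    by (rule card_mono[OF fin nbhd_Suc_subset])
  also have "\<dots> \<le> (\<Sum>w\<in>nbhd r u. card (insert w (R `` {w})))"
    using IH(1) by (rule card_UN_le)
  also have "\<dots> \<le> card (nbhd r u) * (K * 2 ^ Suc r + 1)"
    using sum_bounded_above[of "nbhd r u", OF step] by simp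
  also have "\<dots> \<le> (K * 2 ^ Suc r + 1) ^ r * (K * 2 ^ Suc r + 1)"
    using IH(2) by (intro mult_right_mono, elim order_trans, intro power_mono) simp_all
  finally have "card (nbhd (Suc r) u) \<le> (K * 2 ^ Suc r + 1) ^ Suc r"
    by (simp only: power_Suc2)
  then show ?case
    using finite_subset[OF nbhd_Suc_subset fin] by blast
qed

text \<open>By the geodesic bound, all vertices of degree at most \<open>K\<close> lie in one ball
  around any one of them.\<close>

lemma card_low_degree_le:
  assumes "\<And>u v. u \<in> V \<Longrightarrow> v \<in> V \<Longrightarrow> (u, v) \<in> R\<^sup>*"
  shows "card {v \<in> V. deg v \<le> K} \<le> (K * 2 ^ (2 * K + 2) + 1) ^ (2 * K + 2)"
proof (cases "{v \<in> V. deg v \<le> K} = {}")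
  case True
  then show ?thesis by (simp only: card.empty le0)
next
  case False
  then obtain u where u: "u \<in> V" "deg u \<le> K" by auto
  have "v \<in> nbhd (2 * K + 2) u" if v: "v \<in> V" "deg v \<le> K" for v
  proof -
    obtain n p where p: "geodesic n p" "p 0 = u" "p n = v"
      using assms[OF u(1) v(1)] geodesic_exists by blast
    then have "(u, v) \<in> R ^^ n"
      using path_relpow[of n p 0 n] unfolding geodesic_def by auto
    moreover have "n \<le> 2 * K + 2"
      using geodesic_low_degree[OF p(1)] p u v by blast
    ultimately show ?thesis unfolding nbhd_def by blast
  qed
  then have "{v \<in> V. deg v \<le> K} \<subseteq> nbhd (2 * K + 2) u" by blast
  then show ?thesis
    using nbhd_bound[OF u(2), of "2 * K + 2"] by (meson card_mono le_trans)
qed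

section \<open>Double counting of degrees\<close>

lemma card_edges: "(\<Sum>u\<in>V. deg u) = card R"
proof -
  have "R = (SIGMA u:V. R `` {u})" using R_sub by auto
  then have "card R = card (SIGMA u:V. R `` {u})" by simp
  also have "\<dots> = (\<Sum>u\<in>V. deg u)"
    unfolding deg_def using finite_V finite_nbrs by (subst card_SigmaI) auto
  finally show ?thesis by simp
qed

lemma sum_deg_fst: "(\<Sum>(u, v)\<in>R. deg u) = (\<Sum>u\<in>V. deg u * deg u)"
proof -
  have R: "R = (SIGMA u:V. R `` {u})" using R_sub by auto
  have "(\<Sum>(u, v)\<in>R. deg u) = (\<Sum>(u, v)\<in>(SIGMA u:V. R `` {u}). deg u)"
    using R by simp
  also have "\<dots> = (\<Sum>u\<in>V. \<Sum>v\<in>R `` {u}. deg u)"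
    using finite_V finite_nbrs by (subst sum.Sigma) auto
  finally show ?thesis by (simp add: deg_def)
qed

lemma sum_deg_snd: "(\<Sum>(u, v)\<in>R. deg v) = (\<Sum>(u, v)\<in>R. deg u)"
  using sym_R by (intro sum.reindex_bij_witness[of _ prod.swap prod.swap]) (auto dest: symD)

text \<open>Summing \<open>deg u + deg v\<close> over \<open>R\<close> counts \<open>deg u\<close>
  exactly \<open>2 * deg u\<close> times, so the curvature inequality bounds the sum of squares. The
  factor 2 is dropped at the end.\<close>

lemma sum_deg_square_le:
  assumes "(\<Sum>(u, v)\<in>R. card (A u v)) \<le> C * card R"
  shows "(\<Sum>u\<in>V. deg u * deg u) \<le> (3 * C + 3) * (\<Sum>u\<in>V. deg u)"
proof -
  have "2 * (\<Sum>u\<in>V. deg u * deg u) = (\<Sum>(u, v)\<in>R. deg u + deg v)"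
    using sum_deg_fst sum_deg_snd by (simp add: sum.distrib split_def)
  also have "\<dots> \<le> (\<Sum>(u, v)\<in>R. 3 * card (A u v) + 3)"
    using deg_sum_le by (intro sum_mono) auto
  also have "\<dots> = 3 * (\<Sum>(u, v)\<in>R. card (A u v)) + 3 * card R"
    by (simp add: sum.distrib split_def sum_distrib_left)
  also have "\<dots> \<le> (3 * C + 3) * card R"
    using assms by (simp add: algebra_simps)
  finally have "2 * (\<Sum>u\<in>V. deg u * deg u) \<le> (3 * C + 3) * (\<Sum>u\<in>V. deg u)"
    by (simp only: card_edges)
  then show ?thesis by linarith
qed

text \<open>The sum of \<open>deg u * (deg u - K)\<close> is not positive. A vertex of degree above
  \<open>K\<close> contributes at least 1 to it, any other at least minus \<open>K * K\<close>, so
  there are at most \<open>K * K\<close> high vertices per low one.\<close>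

lemma card_vertices_le:
  assumes conn: "\<And>u v. u \<in> V \<Longrightarrow> v \<in> V \<Longrightarrow> (u, v) \<in> R\<^sup>*"
    and tri: "(\<Sum>(u, v)\<in>R. card (A u v)) \<le> C * card R"
    and K: "K = 3 * C + 3"
  shows "card V \<le> (1 + K * K) * (K * 2 ^ (2 * K + 2) + 1) ^ (2 * K + 2)"
proof -
  define L where "L = {v \<in> V. deg v \<le> K}"
  define H where "H = {v \<in> V. K < deg v}"
  have VLH: "V = L \<union> H" "L \<inter> H = {}" "finite L" "finite H"
    using finite_V by (auto simp: L_def H_def)
  have "int (\<Sum>u\<in>V. deg u * deg u) \<le> int (K * (\<Sum>u\<in>V. deg u))"
    using sum_deg_square_le[OF tri] K by (subst of_nat_le_iff) simp
  then have "(\<Sum>u\<in>V. int (deg u) * (int (deg u) - int K)) \<le> 0"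
    by (simp add: algebra_simps sum_distrib_left sum_subtractf)
  then have "(\<Sum>u\<in>H. int (deg u) * (int (deg u) - int K)) \<le>
      (\<Sum>u\<in>L. int (deg u) * (int K - int (deg u)))"
    unfolding VLH(1) using VLH
    by (simp add: sum.union_disjoint algebra_simps sum_subtractf sum.distrib)
  moreover have "(\<Sum>u\<in>H. 1) \<le> (\<Sum>u\<in>H. int (deg u) * (int (deg u) - int K))"
  proof (rule sum_mono)
    fix u assume "u \<in> H"
    then have "1 \<le> int (deg u)" "1 \<le> int (deg u) - int K"
      by (auto simp: H_def)
    then show "1 \<le> int (deg u) * (int (deg u) - int K)"
      using mult_mono[of 1 "int (deg u)" 1 "int (deg u) - int K"] by simp
  qed
  moreover have "(\<Sum>u\<in>L. int (deg u) * (int K - int (deg u))) \<le> (\<Sum>u\<in>L. int K * int K)"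
    by (intro sum_mono mult_mono) (auto simp: L_def)
  ultimately have "int (card H) \<le> int (card L * (K * K))"
    by simp
  then have "card H \<le> card L * (K * K)"
    by (simp only: of_nat_le_iff)
  then have "card V \<le> (1 + K * K) * card L"
    using VLH by (simp add: card_Un_disjoint algebra_simps)
  also have "\<dots> \<le> (1 + K * K) * (K * 2 ^ (2 * K + 2) + 1) ^ (2 * K + 2)"
    using card_low_degree_le[OF conn, of K] unfolding L_def by (intro mult_le_mono) auto
  finally show ?thesis .
qed

end

section \<open>Simplicial 5-polytopes have at most twice as many facets as edges\<close>

definition vertices :: "'a::euclidean_space set \<Rightarrow> 'a set" where
  "vertices P = {v. v extreme_point_of P}"

lemma vertices_subset: "vertices P \<subseteq> P"
  by (auto simp: vertices_def extreme_point_of_def)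

lemma vertices_face: "F face_of P \<Longrightarrow> vertices F = vertices P \<inter> F"
  by (auto simp: vertices_def extreme_point_of_face)

lemma convex_hull_vertices: "polytope P \<Longrightarrow> convex hull (vertices P) = P"
  unfolding vertices_def
  by (metis Krein_Milman_Minkowski polytope_imp_compact polytope_imp_convex)

lemma finite_vertices: "polytope P \<Longrightarrow> finite (vertices P)"
  unfolding vertices_def by (simp add: finite_polyhedron_extreme_points polytope_imp_polyhedron)

lemma vertices_eq_empty_iff: "polytope P \<Longrightarrow> vertices P = {} \<longleftrightarrow> P = {}"
  using convex_hull_vertices vertices_subset by fastforce

lemma vertices_simplex:
  assumes "n simplex F"
  shows "\<not> affine_dependent (vertices F)" "int (card (vertices F)) = n + 1"
proof -
  obtain C where C: "\<not> affine_dependent C" "int (card C) = n + 1" "F = convex hull C"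
    using assms unfolding simplex_def by blast
  then have "vertices F = C"
    by (auto simp: vertices_def extreme_point_of_convex_hull_affine_independent)
  with C show "\<not> affine_dependent (vertices F)" "int (card (vertices F)) = n + 1" by auto
qed

section \<open>Generic vectors and polar normals of facets\<close>

text \<open>Take \<open>c\<close> avoiding the old subspaces and \<open>d\<close> outside the new
  one. The line through \<open>c\<close> in direction \<open>d\<close> meets each subspace at most
  once, so one of its infinitely many points avoids them all.\<close>

lemma avoid_finitely_many_subspaces:
  fixes S :: "'a::real_vector set"
  assumes "finite \<T>" "subspace S" "\<And>T. T \<in> \<T> \<Longrightarrow> subspace T \<and> \<not> S \<subseteq> T"
  shows "\<exists>c\<in>S. \<forall>T\<in>\<T>. c \<notin> T"
  using assms(1,3)
proof (induction \<T>)
  case empty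
  then show ?case using subspace_0[OF assms(2)] by blast
next
  case (insert T \<T>)
  then obtain c where c: "c \<in> S" "\<forall>T'\<in>\<T>. c \<notin> T'" by blast
  obtain d where d: "d \<in> S" "d \<notin> T" using insert.prems by blast
  have T: "subspace T" using insert.prems by blast
  define bad where "bad T' = {e::real. c + e *\<^sub>R d \<in> T'}" for T'
  have fin: "finite (bad T')" if T': "T' \<in> insert T \<T>" for T'
  proof -
    have sub: "subspace T'" using insert.prems T' by blast
    have "e = f" if "e \<in> bad T'" "f \<in> bad T'" for e f
    proof (rule ccontr)
      assume ne: "e \<noteq> f"
      have e: "c + e *\<^sub>R d \<in> T'" and f: "c + f *\<^sub>R d \<in> T'"
        using that by (auto simp: bad_def)
      have "(e - f) *\<^sub>R d = (c + e *\<^sub>R d) - (c + f *\<^sub>R d)"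
        by (simp add: algebra_simps)
      also have "\<dots> \<in> T'" using sub e f by (rule subspace_diff)
      finally have "(1 / (e - f)) *\<^sub>R ((e - f) *\<^sub>R d) \<in> T'"
        using sub by (rule subspace_scale[rotated])
      then have dT: "d \<in> T'" using ne by simp
      then have "(c + e *\<^sub>R d) - e *\<^sub>R d \<in> T'"
        using sub e by (intro subspace_diff subspace_scale)
      then have "c \<in> T'" by simp
      then show False using c d T' dT by auto
    qed
    then have "\<exists>e. bad T' \<subseteq> {e}" by blast
    then show ?thesis using finite_subset by blast
  qed
  then have "finite (\<Union>T'\<in>insert T \<T>. bad T')"
    using insert.hyps by blast
  then obtain e where "e \<notin> (\<Union>T'\<in>insert T \<T>. bad T')"
    using ex_new_if_finite infinite_UNIV_char_0 by blast
  moreover have "c + e *\<^sub>R d \<in> S"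
    using assms(2) c d by (intro subspace_add subspace_scale)
  ultimately show ?case unfolding bad_def by blast
qed

text \<open>A relative interior point lies strictly inside the supporting half-space, so the
  inequality can be scaled to right side 1 with \<open>p\<close> as origin. This \<open>y\<close>
  represents the vertex of the polar dual corresponding to \<open>F\<close>.\<close>

lemma facet_functional:
  assumes "polytope P" "p \<in> rel_interior P" "F facet_of P"
  obtains y where "\<And>x. x \<in> P \<Longrightarrow> (x - p) \<bullet> y \<le> 1"
    and "\<And>x. x \<in> P \<Longrightarrow> x \<in> F \<longleftrightarrow> (x - p) \<bullet> y = 1"
proof -
  have face: "F face_of P" "F \<noteq> P" "F \<noteq> {}"
    using assms(3) facet_of_irrefl by (auto simp: facet_of_def)
  then have "F exposed_face_of P"
    using assms(1) exposed_face_of_polyhedron polytope_imp_polyhedron by blast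
  then obtain a b where ab: "P \<subseteq> {x. a \<bullet> x \<le> b}" "F = P \<inter> {x. a \<bullet> x = b}"
    unfolding exposed_face_of_def by blast
  have "p \<notin> F"
    using face_of_disjoint_rel_interior[OF face(1,2)] assms(2) by blast
  moreover have "p \<in> P" using assms(2) rel_interior_subset by blast
  ultimately have pos: "0 < b - a \<bullet> p"
    using ab by fastforce
  define y where "y = (1 / (b - a \<bullet> p)) *\<^sub>R a"
  have y: "(x - p) \<bullet> y = (a \<bullet> x - a \<bullet> p) / (b - a \<bullet> p)" for x
    by (simp add: y_def inner_diff_right inner_commute[of "x - p"] diff_divide_distrib)
  show thesis
  proof (rule that[of y])
    fix x assume "x \<in> P"
    then show "(x - p) \<bullet> y \<le> 1" "x \<in> F \<longleftrightarrow> (x - p) \<bullet> y = 1"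
      using ab pos by (auto simp: y)
  qed
qed

lemma facet_of_subset_eq:
  assumes "F facet_of P" "F' facet_of P" "F \<subseteq> F'" "convex P"
  shows "F = F'"
proof (rule ccontr)
  assume "F \<noteq> F'"
  moreover have "F face_of F'"
    using assms face_of_subset by (meson facet_of_imp_face_of facet_of_imp_subset)
  moreover have "convex F'"
    using assms(2) face_of_imp_convex facet_of_imp_face_of by blast
  ultimately have "aff_dim F < aff_dim F'"
    using face_of_aff_dim_lt by blast
  then show False using assms by (simp add: facet_of_def)
qed

section \<open>Facets as highest or lowest facets through an edge\<close>

locale simplicial_polytope5 =
  fixes P :: "'a::euclidean_space set"
  assumes dim5: "d_polytope 5 P"
    and simplicial: "simplicial_polytope P"
begin

lemma polytope_P: "polytope P" and aff_dim_P: "aff_dim P = 5"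
  using dim5 by (auto simp: d_polytope_def)

lemma convex_P: "convex P"
  using polytope_P polytope_imp_convex by blast

lemma proper_face:
  assumes "F face_of P" "F \<noteq> P"
  shows "\<not> affine_dependent (vertices F)" "int (card (vertices F)) = aff_dim F + 1"
    "finite (vertices F)" "convex hull (vertices F) = F" "vertices F = vertices P \<inter> F"
proof -
  obtain n where n: "n simplex F"
    using simplicial assms unfolding simplicial_polytope_def by blast
  with vertices_simplex aff_dim_simplex
  show "\<not> affine_dependent (vertices F)" "int (card (vertices F)) = aff_dim F + 1"
    by (auto simp: aff_dim_simplex)
  show "finite (vertices F)" "convex hull (vertices F) = F"
    using polytope_P assms(1) face_of_polytope_polytope finite_vertices convex_hull_vertices by blast+
  show "vertices F = vertices P \<inter> F"
    using assms(1) by (rule vertices_face)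
qed

text \<open>A proper face is a simplex, so each subset of its vertices spans a face of it, and a
  face of a face is a face of \<open>P\<close>.\<close>

lemma subface:
  assumes "F face_of P" "F \<noteq> P" "S \<subseteq> vertices P" "S \<subseteq> F"
  shows "convex hull S face_of P" "convex hull S \<noteq> P" "vertices (convex hull S) = S"
    "aff_dim (convex hull S) = int (card S) - 1"
proof -
  have S: "S \<subseteq> vertices F" using assms proper_face by blast
  then have indep: "\<not> affine_dependent S"
    using affine_independent_subset proper_face(1)[OF assms(1,2)] by blast
  then show "vertices (convex hull S) = S"
    by (auto simp: vertices_def extreme_point_of_convex_hull_affine_independent)
  have "convex hull S face_of convex hull (vertices F)"
    using S face_of_convex_hull_affine_independent[OF proper_face(1)[OF assms(1,2)]] by blast
  then have "convex hull S face_of F"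
    by (simp add: proper_face(4)[OF assms(1,2)])
  then show "convex hull S face_of P" "convex hull S \<noteq> P"
    using assms(1,2) face_of_trans face_of_imp_subset by blast+
  show "aff_dim (convex hull S) = int (card S) - 1"
    using indep by (simp add: aff_dim_convex_hull affine_independent_iff_card)
qed

lemma facet:
  assumes "F facet_of P"
  shows "F face_of P" "F \<noteq> P" "card (vertices F) = 5"
proof -
  show F: "F face_of P" "F \<noteq> P"
    using assms facet_of_irrefl facet_of_imp_face_of by auto
  show "card (vertices F) = 5"
    using proper_face(2)[OF F] assms by (simp add: facet_of_def aff_dim_P)
qed

text \<open>The vertex sets of the edges: in a simplicial polytope two vertices span an edge iff
  they share a facet.\<close>

definition edge_pairs :: "'a set set" where
  "edge_pairs = {S. card S = 2 \<and> S \<subseteq> vertices P \<and> (\<exists>F. F facet_of P \<and> S \<subseteq> F)}"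

lemma finite_edge_pairs: "finite edge_pairs"
  using finite_vertices[OF polytope_P] unfolding edge_pairs_def
  by (auto intro: finite_subset[of _ "Pow (vertices P)"])

text \<open>In the polar dual, the facets through an edge are the vertices of a face, and a peak is
  the unique top vertex of such a face with respect to \<open>h\<close>.\<close>

definition peak :: "('a set \<Rightarrow> real) \<Rightarrow> 'a set \<Rightarrow> bool" where
  "peak h F \<longleftrightarrow> (\<exists>S\<subseteq>vertices F. card S = 2 \<and>
     (\<forall>F'. F' facet_of P \<longrightarrow> S \<subseteq> F' \<longrightarrow> F' \<noteq> F \<longrightarrow> h F' < h F))"

text \<open>An edge is below at most one peak.\<close>

lemma card_peaks_le: "card {F. F facet_of P \<and> peak h F} \<le> card edge_pairs"
proof -
  let ?M = "{F. F facet_of P \<and> peak h F}"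
  have "\<forall>F\<in>?M. \<exists>S\<subseteq>vertices F. card S = 2 \<and>
     (\<forall>F'. F' facet_of P \<longrightarrow> S \<subseteq> F' \<longrightarrow> F' \<noteq> F \<longrightarrow> h F' < h F)"
    by (simp add: peak_def)
  then obtain g where g: "\<forall>F\<in>?M. g F \<subseteq> vertices F \<and> card (g F) = 2 \<and>
     (\<forall>F'. F' facet_of P \<longrightarrow> g F \<subseteq> F' \<longrightarrow> F' \<noteq> F \<longrightarrow> h F' < h F)"
    by metis
  have vert: "vertices F \<subseteq> F" "vertices F \<subseteq> vertices P" if "F facet_of P" for F
    using vertices_subset proper_face(5)[OF facet(1,2)[OF that]] by auto
  have "inj_on g ?M"
  proof (rule inj_onI, rule ccontr)
    fix F F' assume *: "F \<in> ?M" "F' \<in> ?M" "g F = g F'" "F \<noteq> F'"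
    then have "g F \<subseteq> F" "g F \<subseteq> F'"
      using g vert by (metis (no_types, lifting) mem_Collect_eq subset_trans)+
    with * g have "h F' < h F" "h F < h F'" by (metis (no_types, lifting) mem_Collect_eq)+
    then show False by simp
  qed
  moreover have "g ` ?M \<subseteq> edge_pairs"
    using g vert unfolding edge_pairs_def by blast
  ultimately show ?thesis
    using card_inj_on_le finite_edge_pairs by blast
qed

text \<open>The affine hull of a facet misses the relative interior, so \<open>p\<close> and the
  five vertices are six affinely independent points and span the 5-dimensional affine hull of
  \<open>P\<close>, which may be smaller than the ambient space.\<close>

lemma facet_affine_basis:
  assumes p: "p \<in> rel_interior P" and F: "F facet_of P"
  shows "independent ((\<lambda>x. x - p) ` vertices F)"
    and "span ((\<lambda>x. x - p) ` vertices F) = {v. p + v \<in> affine hull P}"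
proof -
  let ?V = "vertices F"
  note f = facet[OF F]
  have pP: "p \<in> P" using p rel_interior_subset by blast
  have "p \<notin> affine hull F"
    using affine_hull_face_of_disjoint_rel_interior[OF convex_P f(1,2)] p by blast
  then have pV: "p \<notin> affine hull ?V"
    using proper_face(4)[OF f(1,2)] by (metis affine_hull_convex_hull)
  then have p_notin: "p \<notin> ?V" using hull_inc by metis
  have "?V \<noteq> {}" using f(3) by auto
  have aff: "\<not> affine_dependent (insert p ?V)"
    using pV proper_face(1)[OF f(1,2)] by (simp add: affine_independent_insert)
  have "(\<lambda>x. - p + x) ` ?V = (\<lambda>x. x - p) ` ?V" by auto
  with aff affine_dependent_iff_dependent[OF p_notin]
  show "independent ((\<lambda>x. x - p) ` ?V)" by simp
  have "aff_dim (insert p ?V) = int (card (insert p ?V)) - 1"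
    using aff affine_independent_iff_card by blast
  also have "\<dots> = 5"
    using p_notin f(3) proper_face(3)[OF f(1,2)] by simp
  finally have "affine hull (insert p ?V) = affine hull P"
    using pP vertices_subset[of F] facet_of_imp_subset[OF F] aff_dim_P
    by (subst aff_dim_eq_full_gen[symmetric]) auto
  moreover have "affine hull (insert p ?V) = {p + v | v. v \<in> span {x - p | x. x \<in> ?V}}"
    by (rule affine_hull_insert_span[OF p_notin])
  moreover have "{x - p | x. x \<in> ?V} = (\<lambda>x. x - p) ` ?V" by auto
  ultimately show "span ((\<lambda>x. x - p) ` ?V) = {v. p + v \<in> affine hull P}"
    by (auto simp: set_eq_iff) (metis add_left_cancel)
qed

text \<open>Seidel's argument for the asymptotic upper bound theorem, carried out without dualizing. The
  height of a facet is the value of a generic linear functional \<open>c\<close> at the corresponding vertex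
  \<open>y F\<close> of the polar dual. Expanding \<open>c\<close> in the basis given by the five vertices of \<open>F\<close>, at
  least three coefficients share a sign; the edge spanned by two vertices that include the others
  then has \<open>F\<close> as its highest or its lowest facet.\<close>

lemma card_facets_le: "card {F. F facet_of P} \<le> 2 * card edge_pairs"
proof -
  have "P \<noteq> {}" using aff_dim_P by auto
  then obtain p where p: "p \<in> rel_interior P"
    using convex_P rel_interior_eq_empty by blast
  let ?t = "\<lambda>x. x - p"
  define L where "L = {v. p + v \<in> affine hull P}"
  have finF: "finite {F. F facet_of P}"
    using polytope_P by (rule finite_polytope_facets)
  have "\<forall>F\<in>{F. F facet_of P}. \<exists>y. (\<forall>x\<in>P. (x - p) \<bullet> y \<le> 1) \<and> (\<forall>x\<in>P. x \<in> F \<longleftrightarrow> (x - p) \<bullet> y = 1)"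
    using facet_functional[OF polytope_P p] by (metis mem_Collect_eq)
  then obtain y where y: "\<And>F x. F facet_of P \<Longrightarrow> x \<in> P \<Longrightarrow> (x - p) \<bullet> y F \<le> 1"
    "\<And>F x. F facet_of P \<Longrightarrow> x \<in> P \<Longrightarrow> x \<in> F \<longleftrightarrow> (x - p) \<bullet> y F = 1"
    by (metis mem_Collect_eq)
  \<comment> \<open>Avoiding the spans of four of the five translated vertices of a facet makes all
    coefficients of \<open>c\<close> nonzero at every facet.\<close>
  define \<T> where "\<T> = (\<Union>F\<in>{F. F facet_of P}. (\<lambda>a. span (?t ` (vertices F - {a}))) ` vertices F)"
  obtain F0 where F0: "F0 facet_of P"
    using polytope_facet_exists[OF polytope_P] aff_dim_P by auto
  have subL: "subspace L"
    unfolding L_def using facet_affine_basis(2)[OF p F0] subspace_span by metis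
  have finT: "finite \<T>"
    unfolding \<T>_def using finF proper_face(3) facet by (intro finite_UN_I finite_imageI) auto
  have T: "subspace T \<and> \<not> L \<subseteq> T" if "T \<in> \<T>" for T
  proof -
    obtain F a where Fa: "F facet_of P" "a \<in> vertices F" "T = span (?t ` (vertices F - {a}))"
      using \<open>T \<in> \<T>\<close> unfolding \<T>_def by auto
    have eq: "?t ` (vertices F - {a}) = ?t ` vertices F - {?t a}" by auto
    have "?t a \<notin> T" unfolding Fa(3) eq
      using facet_affine_basis(1)[OF p Fa(1)] Fa(2) unfolding dependent_def by blast
    moreover have "?t a \<in> span (?t ` vertices F)"
      using Fa(2) by (intro span_base) blast
    then have "?t a \<in> L"
      unfolding L_def facet_affine_basis(2)[OF p Fa(1)] .
    moreover have "subspace T"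
      unfolding Fa(3) by (rule subspace_span)
    ultimately show ?thesis by blast
  qed
  have "\<exists>c\<in>L. \<forall>T\<in>\<T>. c \<notin> T"
    by (rule avoid_finitely_many_subspaces[OF finT subL T])
  then obtain c where c: "c \<in> L" "\<And>T. T \<in> \<T> \<Longrightarrow> c \<notin> T"
    by blast
  define h where "h F = c \<bullet> y F" for F
  have peaks: "peak h F \<or> peak (\<lambda>F. - h F) F" if F: "F facet_of P" for F
  proof -
    let ?V = "vertices F"
    note f = facet[OF F]
    have finV: "finite ?V" using proper_face(3)[OF f(1,2)] .
    have VF: "?V \<subseteq> F" "F \<subseteq> P"
      using vertices_subset facet_of_imp_subset[OF F] by auto
    have inj: "inj_on ?t ?V" by (simp add: inj_on_def)
    have "c \<in> span (?t ` ?V)"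
      using facet_affine_basis(2)[OF p F] c(1) L_def by blast
    then obtain u where "c = (\<Sum>v\<in>?t ` ?V. u v *\<^sub>R v)"
      using span_finite[of "?t ` ?V"] finV by auto
    then have cu: "c = (\<Sum>a\<in>?V. u (a - p) *\<^sub>R (a - p))"
      using inj by (simp add: sum.reindex)
    define \<gamma> where "\<gamma> a = u (a - p)" for a
    have c\<gamma>: "c = (\<Sum>a\<in>?V. \<gamma> a *\<^sub>R (a - p))" using cu \<gamma>_def by simp
    have nz: "\<gamma> a \<noteq> 0" if a: "a \<in> ?V" for a
    proof
      assume "\<gamma> a = 0"
      then have "c = (\<Sum>a\<in>?V - {a}. \<gamma> a *\<^sub>R (a - p))"
        using c\<gamma> a finV by (simp add: sum.remove)
      then have "c \<in> span (?t ` (?V - {a}))"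
        by (simp only:) (intro span_sum span_scale span_base imageI)
      moreover have "span (?t ` (?V - {a})) \<in> \<T>"
        using a F unfolding \<T>_def by blast
      ultimately show False using c(2) by blast
    qed
    have hF': "h F' = (\<Sum>a\<in>?V. \<gamma> a * ((a - p) \<bullet> y F'))" for F'
      unfolding h_def by (subst c\<gamma>) (simp add: inner_sum_left)
    \<comment> \<open>Since \<open>(a - p) \<bullet> y F = 1\<close> for each vertex
      \<open>a\<close> of \<open>F\<close>, \<open>h F\<close> is the sum of the coefficients. What
      remains are the slacks of these vertices at \<open>F'\<close>.\<close>
    have diff: "h F - h F' = (\<Sum>a\<in>?V. \<gamma> a * (1 - (a - p) \<bullet> y F'))" for F'
    proof -
      have "h F = (\<Sum>a\<in>?V. \<gamma> a)"
        unfolding hF' using y(2)[OF F] VF by (intro sum.cong) auto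
      then show ?thesis
        unfolding hF'[of F'] by (simp add: sum_subtractf right_diff_distrib)
    qed
    \<comment> \<open>Slacks are nonnegative and vanish on \<open>S\<close>. Some vertex of
      \<open>F\<close> lies outside \<open>F'\<close>, as distinct facets are incomparable; its
      slack and coefficient are positive.\<close>
    have key: "(\<Sum>a\<in>?V. \<beta> a * (1 - (a - p) \<bullet> y F')) > 0"
      if \<beta>: "\<And>a. a \<in> ?V \<Longrightarrow> a \<notin> S \<Longrightarrow> \<beta> a > 0" and F': "F' facet_of P" "S \<subseteq> F'" "F' \<noteq> F" for \<beta> S F'
    proof -
      have nn: "\<beta> a * (1 - (a - p) \<bullet> y F') \<ge> 0" if "a \<in> ?V" for a
      proof (cases "a \<in> S")
        case True
        then have "(a - p) \<bullet> y F' = 1"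
          using F' y(2)[OF F'(1)] facet_of_imp_subset[OF F'(1)] by blast
        then show ?thesis by simp
      next
        case False
        then show ?thesis
          using \<beta>[OF that] y(1)[OF F'(1), of a] that VF by (intro mult_nonneg_nonneg) auto
      qed
      have "\<not> F \<subseteq> F'"
        using facet_of_subset_eq[OF F F'(1) _ convex_P] F'(3) by blast
      moreover have "F \<subseteq> F'" if "?V \<subseteq> F'"
      proof -
        have "convex F'" using F'(1) face_of_imp_convex facet_of_imp_face_of by blast
        then have "convex hull ?V \<subseteq> F'" using that by (rule hull_minimal[rotated])
        then show ?thesis using proper_face(4)[OF f(1,2)] by simp
      qed
      ultimately obtain a where a: "a \<in> ?V" "a \<notin> F'" by blast
      then have "a \<in> P" "a \<notin> S" using VF F'(2) by auto
      then have "(a - p) \<bullet> y F' < 1" "\<beta> a > 0"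
        using y(1)[OF F'(1), of a] y(2)[OF F'(1), of a] a \<beta> by auto
      then have "\<beta> a * (1 - (a - p) \<bullet> y F') > 0" by simp
      then show ?thesis
        using nn a(1) finV by (meson sum_pos2)
    qed
    have ext: "\<exists>S\<subseteq>?V. card S = 2 \<and> N \<subseteq> S" if "N \<subseteq> ?V" "card N \<le> 2" for N
      using exists_subset_between[OF that(2) _ that(1)] finV f(3) by auto
    define Pos where "Pos = {a\<in>?V. \<gamma> a > 0}"
    define Neg where "Neg = {a\<in>?V. \<gamma> a < 0}"
    have "?V = Pos \<union> Neg" "Pos \<inter> Neg = {}"
      using nz by (fastforce simp: Pos_def Neg_def)+
    then have "card Pos + card Neg = 5"
      using f(3) finV by (metis card_Un_disjoint finite_Un)
    then consider "card Neg \<le> 2" | "card Pos \<le> 2" by linarith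
    then show ?thesis
    proof cases
      case 1
      then obtain S where S: "S \<subseteq> ?V" "card S = 2" "Neg \<subseteq> S"
        using ext[of Neg] Neg_def by auto
      have "h F' < h F" if F': "F' facet_of P" "S \<subseteq> F'" "F' \<noteq> F" for F'
        using key[of S \<gamma>, OF _ F'] diff[of F'] S(3) nz by (force simp: Neg_def)
      then have "peak h F" unfolding peak_def using S by blast
      then show ?thesis ..
    next
      case 2
      then obtain S where S: "S \<subseteq> ?V" "card S = 2" "Pos \<subseteq> S"
        using ext[of Pos] Pos_def by auto
      have "- h F' < - h F" if F': "F' facet_of P" "S \<subseteq> F'" "F' \<noteq> F" for F'
        using key[of S "\<lambda>a. - \<gamma> a", OF _ F'] diff[of F'] S(3) nz
        by (force simp: Pos_def sum_negf)
      then have "peak (\<lambda>F. - h F) F" unfolding peak_def using S by blast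
      then show ?thesis ..
    qed
  qed
  then have "{F. F facet_of P} = {F. F facet_of P \<and> peak h F} \<union> {F. F facet_of P \<and> peak (\<lambda>F. - h F) F}"
    by blast
  then have "card {F. F facet_of P} \<le>
      card {F. F facet_of P \<and> peak h F} + card {F. F facet_of P \<and> peak (\<lambda>F. - h F) F}"
    by (metis card_Un_le)
  also have "\<dots> \<le> 2 * card edge_pairs"
    using card_peaks_le[of h] card_peaks_le[of "\<lambda>F. - h F"] by linarith
  finally show ?thesis .
qed

end

section \<open>The graph of a simplicial 5-polytope\<close>

context simplicial_polytope5
begin

section \<open>Curvature in terms of degrees and triangles\<close>

text \<open>Facets stand in for edges: two vertices of a facet span an edge because the facet is a
  simplex.\<close>

definition adj :: "('a \<times> 'a) set" where
  "adj = {(u, v). u \<in> vertices P \<and> v \<in> vertices P \<and> u \<noteq> v \<and> (\<exists>F. F facet_of P \<and> u \<in> F \<and> v \<in> F)}"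

definition tri :: "'a \<Rightarrow> 'a \<Rightarrow> 'a set" where
  "tri u v = {w \<in> vertices P. w \<noteq> u \<and> w \<noteq> v \<and> (\<exists>F. F facet_of P \<and> u \<in> F \<and> v \<in> F \<and> w \<in> F)}"

lemma sym_adj: "sym adj"
  by (auto simp: adj_def sym_def)

lemma tri_commute: "tri u v = tri v u"
  by (auto simp: tri_def)

lemma tri_subset: "(u, v) \<in> adj \<Longrightarrow> tri u v \<subseteq> adj `` {u} \<inter> adj `` {v}"
  by (auto simp: tri_def adj_def)

lemma finite_adj_nbrs: "finite (adj `` {u})"
  using finite_vertices[OF polytope_P]
  by (rule finite_subset[rotated]) (auto simp: adj_def)

lemma finite_tri: "finite (tri u v)"
  using finite_vertices[OF polytope_P]
  by (rule finite_subset[rotated]) (auto simp: tri_def)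

lemma edge_of_adj:
  assumes "(u, v) \<in> adj"
  shows "convex hull {u, v} edge_of P" "vertices (convex hull {u, v}) = {u, v}"
proof -
  obtain F where F: "F facet_of P" "u \<in> F" "v \<in> F" and uv: "{u, v} \<subseteq> vertices P" "u \<noteq> v"
    using assms by (auto simp: adj_def)
  from F have sub: "{u, v} \<subseteq> F" by simp
  show "convex hull {u, v} edge_of P" "vertices (convex hull {u, v}) = {u, v}"
    using subface[OF facet(1,2)[OF F(1)] uv(1) sub] uv(2) by (simp_all add: edge_of_def)
qed

lemma two_face_vertices:
  assumes F: "two_face_of F P" and uv: "(u, v) \<in> adj" "u \<in> F" "v \<in> F"
  obtains w where "w \<in> tri u v" "vertices F = {u, v, w}"
proof -
  have face: "F face_of P" "F \<noteq> P" "F \<noteq> {}"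
    using F aff_dim_P uv by (auto simp: two_face_of_def)
  note pf = proper_face[OF face(1,2)]
  have "card (vertices F) = 3"
    using pf(2) F by (simp add: two_face_of_def)
  moreover have mem: "u \<in> vertices F" "v \<in> vertices F" "u \<noteq> v"
    using uv pf(5) by (auto simp: adj_def)
  ultimately have "card (vertices F - {u, v}) = 1"
    by (simp add: card_Diff_subset)
  then obtain w where w: "vertices F - {u, v} = {w}"
    using card_1_singletonE by blast
  obtain F' where "F' facet_of P" "F \<subseteq> F'"
    using face_of_polyhedron_subset_facet[OF polytope_imp_polyhedron[OF polytope_P] face(1,3,2)] by blast
  then have "w \<in> tri u v"
    using w uv pf(5) by (auto simp: tri_def)
  with that mem w show thesis by blast
qed

text \<open>A 2-face is the hull of its vertices, hence determined by its third vertex. These faces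
  enter the curvature positively, so their number is bounded from above.\<close>

lemma card_two_faces_above_le:
  assumes "(u, v) \<in> adj"
  shows "card (two_faces_above P (convex hull {u, v})) \<le> card (tri u v)"
proof (rule surj_card_le[OF finite_tri])
  show "two_faces_above P (convex hull {u, v}) \<subseteq> (\<lambda>w. convex hull {u, v, w}) ` tri u v"
  proof
    fix F assume "F \<in> two_faces_above P (convex hull {u, v})"
    then have F: "two_face_of F P" "convex hull {u, v} \<subseteq> F"
      by (auto simp: two_faces_above_def)
    have uv: "u \<in> F" "v \<in> F"
      using F(2) hull_subset[of "{u, v}" convex] by auto
    obtain w where w: "w \<in> tri u v" "vertices F = {u, v, w}"
      using two_face_vertices[OF F(1) assms uv] .
    have "F face_of P" "F \<noteq> P"
      using F(1) aff_dim_P by (auto simp: two_face_of_def)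
    from proper_face(4)[OF this] have "F = convex hull {u, v, w}"
      by (simp add: w(2))
    with w(1) show "F \<in> (\<lambda>w. convex hull {u, v, w}) ` tri u v" by blast
  qed
qed

text \<open>A common 2-face would be a triangle on \<open>u\<close>, \<open>v\<close> and some
  \<open>x\<close> in \<open>tri u v\<close>, leaving no place for \<open>w\<close>.\<close>

lemma parallel_neighbor:
  assumes uv: "(u, v) \<in> adj" and w: "(u, w) \<in> adj" "w \<noteq> v" "w \<notin> tri u v"
  shows "convex hull {u, w} \<in> parallel_neighbors P (convex hull {u, v})"
proof -
  have "u \<in> vertices P" using uv by (simp add: adj_def)
  then have "share_vertex P (convex hull {u, v}) (convex hull {u, w})"
    unfolding share_vertex_def by (intro exI[of _ u]) (auto simp: vertices_def hull_inc)
  moreover have "\<not> in_common_two_face P (convex hull {u, v}) (convex hull {u, w})"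
  proof
    assume "in_common_two_face P (convex hull {u, v}) (convex hull {u, w})"
    then obtain F where F: "two_face_of F P" "convex hull {u, v} \<subseteq> F" "convex hull {u, w} \<subseteq> F"
      by (auto simp: in_common_two_face_def)
    then have mem: "u \<in> F" "v \<in> F" "w \<in> F"
      using hull_subset[of "{u, v}" convex] hull_subset[of "{u, w}" convex] by auto
    obtain x where x: "x \<in> tri u v" "vertices F = {u, v, x}"
      using two_face_vertices[OF F(1) uv mem(1,2)] .
    have "w \<in> vertices F"
      using vertices_face[of F P] F(1) mem w(1) by (auto simp: two_face_of_def adj_def)
    with x w show False by (auto simp: adj_def)
  qed
  moreover have "convex hull {u, w} \<noteq> convex hull {u, v}"
    using edge_of_adj(2)[OF uv] edge_of_adj(2)[OF w(1)] w(2) by (metis doubleton_eq_iff)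
  ultimately show ?thesis
    using edge_of_adj(1)[OF w(1)] by (simp add: parallel_neighbors_def)
qed

text \<open>All but \<open>card (tri u v) + 1\<close> of the edges at \<open>u\<close> are parallel
  neighbors, and likewise at \<open>v\<close>. The two families are disjoint, as only the edge
  \<open>uv\<close> contains both ends.\<close>

lemma card_parallel_neighbors_ge:
  assumes uv: "(u, v) \<in> adj"
  shows "card (adj `` {u}) + card (adj `` {v}) \<le>
    card (parallel_neighbors P (convex hull {u, v})) + 2 * card (tri u v) + 2"
proof -
  have vu: "(v, u) \<in> adj" using uv sym_adj by (auto dest: symD)
  let ?X = "\<lambda>u v. (\<lambda>w. convex hull {u, w}) ` (adj `` {u} - insert v (tri u v))"
  have card: "card (?X u v) + card (tri u v) + 1 = card (adj `` {u})" if uv: "(u, v) \<in> adj" for u v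
  proof -
    have "inj_on (\<lambda>w. convex hull {u, w}) (adj `` {u} - insert v (tri u v))"
      using edge_of_adj(2)[of u] by (intro inj_onI) (metis DiffD1 Image_singleton_iff doubleton_eq_iff)
    then have "card (?X u v) = card (adj `` {u} - insert v (tri u v))"
      by (rule card_image)
    also have "\<dots> = card (adj `` {u}) - card (insert v (tri u v))"
      using uv tri_subset[OF uv] finite_tri by (intro card_Diff_subset) auto
    finally have "card (?X u v) = card (adj `` {u}) - card (insert v (tri u v))" .
    moreover have "card (insert v (tri u v)) \<le> card (adj `` {u})"
      using uv tri_subset[OF uv] finite_adj_nbrs by (intro card_mono) auto
    moreover have "card (insert v (tri u v)) = card (tri u v) + 1"
      using finite_tri by (simp add: tri_def)
    ultimately show ?thesis by linarith
  qed
  have "?X u v \<inter> ?X v u = {}"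
  proof (rule ccontr)
    assume "?X u v \<inter> ?X v u \<noteq> {}"
    then obtain w w' where w: "(u, w) \<in> adj" "w \<noteq> v" "(v, w') \<in> adj"
      "convex hull {u, w} = convex hull {v, w'}" by blast
    then have "{u, w} = {v, w'}" using edge_of_adj(2) by metis
    with w(2) uv show False by (auto simp: adj_def doubleton_eq_iff)
  qed
  then have "card (?X u v) + card (?X v u) = card (?X u v \<union> ?X v u)"
    using finite_adj_nbrs by (intro card_Un_disjoint[symmetric]) auto
  also have "\<dots> \<le> card (parallel_neighbors P (convex hull {u, v}))"
  proof (rule card_mono)
    show "finite (parallel_neighbors P (convex hull {u, v}))"
      using finite_polytope_faces[OF polytope_P]
      by (rule finite_subset[rotated]) (auto simp: parallel_neighbors_def edge_of_def)
    show "?X u v \<union> ?X v u \<subseteq> parallel_neighbors P (convex hull {u, v})"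
      using parallel_neighbor[OF uv] parallel_neighbor[OF vu]
      by (auto simp: tri_commute insert_commute)
  qed
  finally show ?thesis
    using card[OF uv] card[OF vu] by (simp add: tri_commute)
qed

text \<open>With \<open>t\<close> for the size of \<open>tri u v\<close> and \<open>a\<close>,
  \<open>b\<close> for the degrees, the two estimates give
  \<open>0 < t + 2 - (a + b - 2 * t - 2)\<close>.\<close>

lemma adj_curvature:
  assumes "forman_ricci_positive P" "(u, v) \<in> adj"
  shows "card (adj `` {u}) + card (adj `` {v}) \<le> 3 * card (tri u v) + 3"
proof -
  have "forman_ricci P (convex hull {u, v}) > 0"
    using assms edge_of_adj(1) by (auto simp: forman_ricci_positive_def)
  then show ?thesis
    using card_two_faces_above_le[OF assms(2)] card_parallel_neighbors_ge[OF assms(2)]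
    unfolding forman_ricci_def by linarith
qed

section \<open>Connectedness of the graph\<close>

lemma vertex_in_facet:
  assumes "v \<in> vertices P"
  obtains F where "F facet_of P" "v \<in> F"
proof -
  have "{v} face_of P" using assms by (simp add: vertices_def face_of_singleton)
  moreover have "{v} \<noteq> P" using aff_dim_P by auto
  ultimately show thesis
    using face_of_polyhedron_subset_facet[OF polytope_imp_polyhedron[OF polytope_P], of "{v}"] that
    by blast
qed

text \<open>Otherwise split the facets into those with a vertex reachable from \<open>u\<close> and
  those without. Their unions \<open>X\<close> and \<open>Y\<close> are closed, nonempty and cover
  the boundary. They are disjoint because meeting facets share a vertex and vertices of one facet
  are adjacent. But the boundary is a connected sphere.\<close>

lemma adj_connected:
  assumes "u \<in> vertices P" "v \<in> vertices P"
  shows "(u, v) \<in> adj\<^sup>*"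
proof (rule ccontr)
  assume uv: "(u, v) \<notin> adj\<^sup>*"
  define X where "X = \<Union>{F. F facet_of P \<and> (\<exists>w\<in>vertices F. (u, w) \<in> adj\<^sup>*)}"
  define Y where "Y = \<Union>{F. F facet_of P \<and> (\<forall>w\<in>vertices F. (u, w) \<notin> adj\<^sup>*)}"
  have XY: "rel_frontier P = X \<union> Y"
    unfolding X_def Y_def rel_frontier_of_polyhedron[OF polytope_imp_polyhedron[OF polytope_P]] by blast
  have fin: "finite {F. F facet_of P}"
    using polytope_P by (rule finite_polytope_facets)
  have closed_facet: "closed F" if "F facet_of P" for F
    using that polytope_P by (meson face_of_polytope_polytope facet_of_imp_face_of polytope_imp_closed)
  have closed: "closed X" "closed Y"
    unfolding X_def Y_def using fin closed_facet by (auto intro!: closed_Union)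
  have vert: "w \<in> vertices F" if "F facet_of P" "w \<in> vertices P" "w \<in> F" for w F
    using that proper_face(5)[OF facet(1,2)[OF that(1)]] by blast
  obtain Fu where "Fu facet_of P" "u \<in> Fu" using vertex_in_facet[OF assms(1)] .
  then have uX: "u \<in> X" unfolding X_def using vert assms(1) by blast
  obtain Fv where Fv: "Fv facet_of P" "v \<in> Fv" using vertex_in_facet[OF assms(2)] .
  have reach: "(u, w) \<in> adj\<^sup>*"
    if F: "F facet_of P" and x: "x \<in> vertices F" "(u, x) \<in> adj\<^sup>*" and w: "w \<in> vertices F" for F x w
  proof (cases "x = w")
    case False
    have "vertices F = vertices P \<inter> F" using proper_face(5)[OF facet(1,2)[OF F]] .
    then have "(x, w) \<in> adj" using x w False F by (auto simp: adj_def)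
    with x(2) show ?thesis by (rule rtrancl_into_rtrancl)
  qed (use x in simp)
  have "(u, w) \<notin> adj\<^sup>*" if "w \<in> vertices Fv" for w
    using reach[OF Fv(1) that _ vert[OF Fv(1) assms(2) Fv(2)]] uv by blast
  then have vY: "v \<in> Y" unfolding Y_def using Fv by blast
  have "X \<inter> Y = {}"
  proof (rule ccontr)
    assume "X \<inter> Y \<noteq> {}"
    then obtain F F' where F: "F facet_of P" "\<exists>w\<in>vertices F. (u, w) \<in> adj\<^sup>*"
      and F': "F' facet_of P" "\<forall>w\<in>vertices F'. (u, w) \<notin> adj\<^sup>*" and ne: "F \<inter> F' \<noteq> {}"
      unfolding X_def Y_def by blast
    have face: "F \<inter> F' face_of P"
      using F F' facet(1) by (intro face_of_Int) auto
    then have "vertices (F \<inter> F') \<noteq> {}"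
      using ne vertices_eq_empty_iff face_of_polytope_polytope[OF polytope_P] by blast
    then obtain w where "w \<in> vertices P" "w \<in> F" "w \<in> F'"
      using vertices_face[OF face] by blast
    then have "w \<in> vertices F" "w \<in> vertices F'"
      using vert F F' by blast+
    then show False using F F' reach by blast
  qed
  moreover have "connected (rel_frontier P)"
    using convex_P polytope_imp_bounded[OF polytope_P] aff_dim_P by (intro connected_sphere_gen) auto
  ultimately show False
    using closed uX vY XY unfolding connected_closed by blast
qed

section \<open>Counting triangles by facets\<close>

lemma card_edge_pairs_le: "card edge_pairs \<le> card adj"
proof (rule surj_card_le)
  show "finite adj"
    using finite_vertices[OF polytope_P]
    by (intro finite_subset[of adj "vertices P \<times> vertices P"]) (auto simp: adj_def)
  show "edge_pairs \<subseteq> (\<lambda>(u, v). {u, v}) ` adj"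
  proof
    fix S assume "S \<in> edge_pairs"
    then obtain F where S: "card S = 2" "S \<subseteq> vertices P" "F facet_of P" "S \<subseteq> F"
      by (auto simp: edge_pairs_def)
    then obtain u v where "S = {u, v}" "u \<noteq> v" by (meson card_2_iff)
    with S have "(u, v) \<in> adj" by (auto simp: adj_def)
    with \<open>S = {u, v}\<close> show "S \<in> (\<lambda>(u, v). {u, v}) ` adj" by force
  qed
qed

text \<open>The ordered triples counted on the left each lie in a facet, and a facet carries
  \<open>5 ^ 3 = 125\<close> triples of vertices. Facets are at most twice as many as edges, hence
  250.\<close>

lemma sum_tri_le: "(\<Sum>(u, v)\<in>adj. card (tri u v)) \<le> 250 * card adj"
proof -
  have finF: "finite {F. F facet_of P}"
    using polytope_P by (rule finite_polytope_facets)
  have fin: "finite (vertices F)" if "F facet_of P" for F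
    using proper_face(3) facet[OF that] by blast
  have "finite adj"
    using finite_vertices[OF polytope_P]
    by (intro finite_subset[of adj "vertices P \<times> vertices P"]) (auto simp: adj_def)
  then have "(\<Sum>(u, v)\<in>adj. card (tri u v)) = card (SIGMA e:adj. tri (fst e) (snd e))"
    using finite_tri by (simp add: card_SigmaI split_def)
  also have "\<dots> \<le> card (\<Union>F\<in>{F. F facet_of P}. (vertices F \<times> vertices F) \<times> vertices F)"
  proof (rule card_mono)
    show "finite (\<Union>F\<in>{F. F facet_of P}. (vertices F \<times> vertices F) \<times> vertices F)"
      using finF fin by (intro finite_UN_I finite_cartesian_product) auto
    show "(SIGMA e:adj. tri (fst e) (snd e)) \<subseteq>
        (\<Union>F\<in>{F. F facet_of P}. (vertices F \<times> vertices F) \<times> vertices F)"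
      using proper_face(5)[OF facet(1,2)] by (fastforce simp: adj_def tri_def)
  qed
  also have "\<dots> \<le> (\<Sum>F\<in>{F. F facet_of P}. card ((vertices F \<times> vertices F) \<times> vertices F))"
    using finF by (rule card_UN_le)
  also have "\<dots> = 125 * card {F. F facet_of P}"
    by (simp add: card_cartesian_product facet(3))
  also have "\<dots> \<le> 250 * card adj"
    using card_facets_le card_edge_pairs_le by linarith
  finally show ?thesis .
qed

lemma forman_graph:
  assumes "forman_ricci_positive P"
  shows "positively_curved_graph (vertices P) adj tri"
proof
  show "finite (vertices P)" using finite_vertices[OF polytope_P] .
  show "adj \<subseteq> vertices P \<times> vertices P" by (auto simp: adj_def)
  show "sym adj" by (rule sym_adj)
  show "(u, u) \<notin> adj" for u by (simp add: adj_def)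
  show "tri u v \<subseteq> adj `` {u} \<inter> adj `` {v}" if "(u, v) \<in> adj" for u v
    using that by (rule tri_subset)
  show "card (adj `` {u}) + card (adj `` {v}) \<le> 3 * card (tri u v) + 3" if "(u, v) \<in> adj" for u v
    using assms that by (rule adj_curvature)
qed

end

lemma forman_ricci_positive_vertices_bounded:
  "\<exists>N. \<forall>P :: 'a::euclidean_space set. d_polytope 5 P \<longrightarrow> simplicial_polytope P \<longrightarrow>
    forman_ricci_positive P \<longrightarrow> card (vertices P) \<le> N"
proof -
  \<comment> \<open>250 is the constant of \<open>sum_tri_le\<close>, inserted for \<open>C\<close>
    in \<open>card_vertices_le\<close>.\<close>
  define K :: nat where "K = 3 * 250 + 3"
  define N where "N = (1 + K * K) * (K * 2 ^ (2 * K + 2) + 1) ^ (2 * K + 2)"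
  have "card (vertices P) \<le> N"
    if "d_polytope 5 P" "simplicial_polytope P" "forman_ricci_positive P" for P :: "'a set"
  proof -
    interpret simplicial_polytope5 P using that by unfold_locales
    interpret positively_curved_graph "vertices P" adj tri
      using that(3) by (rule forman_graph)
    show ?thesis
      unfolding N_def using adj_connected sum_tri_le K_def by (rule card_vertices_le)
  qed
  then show ?thesis by blast
qed

section \<open>Counting combinatorial types\<close>

text \<open>Each class is the class of the chosen preimage of its code, so there are no more classes
  than codes.\<close>

lemma finite_quotient_if_code:
  assumes "finite (f ` A)" "equiv B r" "A \<subseteq> B" "\<And>x y. x \<in> A \<Longrightarrow> y \<in> A \<Longrightarrow> f x = f y \<Longrightarrow> (x, y) \<in> r"
  shows "finite (A // r)"
proof -
  have "A // r \<subseteq> (\<lambda>c. r `` {inv_into A f c}) ` f ` A"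
  proof
    fix X assume "X \<in> A // r"
    then obtain x where x: "x \<in> A" "X = r `` {x}" by (auto simp: quotient_def)
    have "(inv_into A f (f x), x) \<in> r"
      using x by (intro assms(4) inv_into_into f_inv_into_f) auto
    then have "r `` {inv_into A f (f x)} = X"
      using x(2) equiv_class_eq[OF assms(2)] by simp
    with x(1) show "X \<in> (\<lambda>c. r `` {inv_into A f c}) ` f ` A" by blast
  qed
  then show ?thesis using assms(1) finite_surj by blast
qed

section \<open>Codes of face lattices\<close>

text \<open>Any numbering serves: equal codes force equivalence whichever numberings were
  chosen.\<close>

definition vertex_index :: "'a::euclidean_space set \<Rightarrow> 'a \<Rightarrow> nat" where
  "vertex_index P = (SOME g. bij_betw g (vertices P) {..<card (vertices P)})"

lemma bij_vertex_index:
  assumes "polytope P"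
  shows "bij_betw (vertex_index P) (vertices P) {..<card (vertices P)}"
proof -
  have "\<exists>g. bij_betw g (vertices P) {..<card (vertices P)}"
    using ex_bij_betw_finite_nat[OF finite_vertices[OF assms]] by (simp only: atLeast0LessThan)
  then show ?thesis
    unfolding vertex_index_def by (rule someI_ex)
qed

definition face_code :: "'a::euclidean_space set \<Rightarrow> nat set set" where
  "face_code P = (\<lambda>F. vertex_index P ` vertices F) ` {F. F face_of P}"

text \<open>A face is the hull of its vertices, so coding is an order isomorphism from the faces
  onto \<open>face_code\<close>. The equivalence codes a face of \<open>P\<close> and decodes the
  result in \<open>Q\<close>.\<close>

lemma face_code_equiv:
  fixes P Q :: "'a::euclidean_space set"
  assumes "polytope P" "polytope Q" "face_code P = face_code Q"
  shows "comb_equiv P Q"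
proof -
  define code where "code P F = vertex_index P ` vertices F" for P F :: "'a set"
  have code: "F \<subseteq> F' \<longleftrightarrow> code P F \<subseteq> code P F'" if P: "polytope P" and F: "F face_of P" "F' face_of P" for P F F' :: "'a set"
  proof -
    have inj: "inj_on (vertex_index P) (vertices P)"
      using bij_vertex_index[OF P] by (rule bij_betw_imp_inj_on)
    have v: "vertices F = vertices P \<inter> F" "vertices F' = vertices P \<inter> F'"
      using F vertices_face by blast+
    have "code P F \<subseteq> code P F' \<longleftrightarrow> vertices F \<subseteq> vertices F'"
      unfolding code_def v by (rule inj_on_image_subset_iff[OF inj]) simp_all
    also have "\<dots> \<longleftrightarrow> F \<subseteq> F'"
    proof
      assume "vertices F \<subseteq> vertices F'"
      then have "convex hull (vertices F) \<subseteq> convex hull (vertices F')"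
        by (rule hull_mono)
      then show "F \<subseteq> F'"
        by (simp add: convex_hull_vertices face_of_polytope_polytope[OF P] F)
    next
      assume "F \<subseteq> F'"
      then show "vertices F \<subseteq> vertices F'" unfolding v by blast
    qed
    finally show ?thesis by simp
  qed
  have bij: "bij_betw (code P) {F. F face_of P} (face_code P)" if P: "polytope P" for P :: "'a set"
  proof -
    have "inj_on (code P) {F. F face_of P}"
      using code[OF P] by (intro inj_onI) (metis mem_Collect_eq order_refl subset_antisym)
    moreover have "code P ` {F. F face_of P} = face_code P"
      by (simp add: face_code_def code_def)
    ultimately show ?thesis by (simp add: bij_betw_def)
  qed
  let ?\<phi> = "inv_into {F. F face_of Q} (code Q) \<circ> code P"
  have "bij_betw ?\<phi> {F. F face_of P} {G. G face_of Q}"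
    using bij[OF assms(1)] bij_betw_inv_into[OF bij[OF assms(2)]] assms(3)
    by (metis bij_betw_trans)
  moreover have "F \<subseteq> F' \<longleftrightarrow> ?\<phi> F \<subseteq> ?\<phi> F'" if F: "F face_of P" "F' face_of P" for F F'
  proof -
    have *: "?\<phi> F face_of Q \<and> code Q (?\<phi> F) = code P F" if "F face_of P" for F
    proof -
      have "code P F \<in> face_code Q"
        using bij_betwE[OF bij[OF assms(1)]] that assms(3) by blast
      then have m: "code P F \<in> code Q ` {F. F face_of Q}"
        using bij[OF assms(2)] by (simp add: bij_betw_def)
      from inv_into_into[OF m] f_inv_into_f[OF m] show ?thesis by simp
    qed
    show ?thesis
      using code[OF assms(1) F] code[OF assms(2)] *[OF F(1)] *[OF F(2)] by metis
  qed
  ultimately show ?thesis unfolding comb_equiv_def by blast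
qed

lemma face_code_bounded:
  assumes "polytope P" "card (vertices P) \<le> N"
  shows "face_code P \<subseteq> Pow {..<N}"
proof -
  have "vertex_index P ` vertices P \<subseteq> {..<N}"
    using bij_vertex_index[OF assms(1)] assms(2) by (auto simp: bij_betw_def)
  then show ?thesis
    unfolding face_code_def using vertices_face by blast
qed

theorem theorem1p12:
  shows "finite ({P :: 'a::euclidean_space set. d_polytope 5 P \<and> simplicial_polytope P \<and>
            forman_ricci_positive P} // comb_equiv_rel)"
    (is "finite (?A // _)")
proof -
  obtain N where N: "\<And>P :: 'a set. P \<in> ?A \<Longrightarrow> card (vertices P) \<le> N"
    using forman_ricci_positive_vertices_bounded by blast
  have poly: "polytope P" if "P \<in> ?A" for P
    using that by (simp add: d_polytope_def)
  show ?thesis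
  proof (rule finite_quotient_if_code[OF _ equiv_comb_equiv_rel])
    have "face_code ` ?A \<subseteq> Pow (Pow {..<N})"
      using face_code_bounded[OF poly N] by blast
    then show "finite (face_code ` ?A)"
      by (rule finite_subset) simp
    show "?A \<subseteq> {P. polytope P}" using poly by blast
    show "(P, Q) \<in> comb_equiv_rel" if "P \<in> ?A" "Q \<in> ?A" "face_code P = face_code Q" for P Q
      using face_code_equiv[OF poly[OF that(1)] poly[OF that(2)] that(3)]
        poly[OF that(1)] poly[OF that(2)] by (simp add: comb_equiv_rel_def)
  qed
qed

end
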